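(* Let $a$ be a positive integer with $a \equiv 0$ or $2 \pmod 6$ and let $b$ be an odd positive integer. Then $$f(a,b) \geq (b-1)\,C_*(a) + C(a).$$
   Context: Let $A,B$ be disjoint finite sets. A system $\mathcal{Q}$ of quadruples (4-element subsets) of $V=A\cup B$ is called an $(A,B)$-system if every triple (3-element subset) $T \subset V$ with $|T\cap A| \geq 2$ is contained in one of the members (blocks) of $\mathcal{Q}$. $f(a,b)$ denotes the minimum size of an $(A,B)$-system with $|A|=a$, $|B|=b$ (taken to be $+\infty$ if no such system exists, which can only happen when $a+b=3$). For a system $\mathcal{T}$ of triples on a finite set $A$, its weight $w(\mathcal{T})$ is the number of triples in $\mathcal{T}$ plus one-half of the number of pairs (2-element subsets) of $A$ not contained in any triple of $\mathcal{T}$. $C_*(a)$ denotes the minimum weight of a system of triples on an $a$-element set. $C(a)=C(a,3,2)$ denotes the minimum size of a system of triples on an $a$-element set such that every pair of elements is contained in at least one triple; it is known (Fort and Hedlund) that $C(a)=\left\lceil\frac{a}{3}\left\lceil\frac{a-1}{2}\right\rceil\right\rceil$, and for $a=2$ the value is understood through this formula, $C(2)=1$. *)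

theory Defs
  imports Complex_Main "HOL-Library.Extended_Real"
begin

definition AB_system :: "'v set \<Rightarrow> 'v set \<Rightarrow> 'v set set \<Rightarrow> bool" where
  "AB_system A B Q \<longleftrightarrow>
     (\<forall>q\<in>Q. q \<subseteq> A \<union> B \<and> card q = 4) \<and>
     (\<forall>T. T \<subseteq> A \<union> B \<and> card T = 3 \<and> card (T \<inter> A) \<ge> 2 \<longrightarrow> (\<exists>q\<in>Q. T \<subseteq> q))"

text \<open>The value is \<open>\<infinity>\<close> if there is no system at all (the infimum of the empty set); otherwise the
  infimum is attained, see \<open>f_attained\<close>. Finite sets of natural numbers represent all finite sets.\<close>

definition f :: "nat \<Rightarrow> nat \<Rightarrow> enat" where
  "f a b = Inf {enat (card Q) | Q. \<exists>A B :: nat set. finite A \<and> finite B \<and> A \<inter> B = {} \<and>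
                   card A = a \<and> card B = b \<and> AB_system A B Q}"

definition triple_system :: "'v set \<Rightarrow> 'v set set \<Rightarrow> bool" where
  "triple_system A \<T> \<longleftrightarrow> (\<forall>t\<in>\<T>. t \<subseteq> A \<and> card t = 3)"

definition weight :: "'v set \<Rightarrow> 'v set set \<Rightarrow> real" where
  "weight A \<T> = real (card \<T>) + real (card {p. p \<subseteq> A \<and> card p = 2 \<and> \<not> (\<exists>t\<in>\<T>. p \<subseteq> t)}) / 2"

text \<open>The minimum exists, see \<open>C_star_attained\<close> and \<open>C_star_le\<close>.\<close>

definition C_star :: "nat \<Rightarrow> real" where
  "C_star a = (LEAST w. \<exists>(A :: nat set) \<T>. finite A \<and> card A = a \<and> triple_system A \<T> \<and> w = weight A \<T>)"

text \<open>No triple system covers the pair of a two-element set. By convention \<open>C 2\<close> is the value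
  \<open>\<lceil>2/3 * \<lceil>1/2\<rceil>\<rceil> = 1\<close> of the Fort-Hedlund formula \<open>\<lceil>a/3 * \<lceil>(a-1)/2\<rceil>\<rceil>\<close>.\<close>

definition C :: "nat \<Rightarrow> nat" where
  "C a = (if a = 2 then 1 else
     (LEAST n. \<exists>(A :: nat set) \<T>. finite A \<and> card A = a \<and> triple_system A \<T> \<and>
        (\<forall>p. p \<subseteq> A \<and> card p = 2 \<longrightarrow> (\<exists>t\<in>\<T>. p \<subseteq> t)) \<and> n = card \<T>))"

lemma f_attained:
  assumes "f a b \<noteq> \<infinity>"
  shows "\<exists>(A :: nat set) B Q. finite A \<and> finite B \<and> A \<inter> B = {} \<and> card A = a \<and> card B = b \<and>
           AB_system A B Q \<and> f a b = enat (card Q)"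
proof -
  let ?S = "{enat (card Q) | Q. \<exists>A B :: nat set. finite A \<and> finite B \<and> A \<inter> B = {} \<and>
                   card A = a \<and> card B = b \<and> AB_system A B Q}"
  have "?S \<noteq> {}"
    using assms unfolding f_def by (metis Inf_empty top_enat_def)
  then obtain x where "x \<in> ?S" by blast
  then have "f a b \<in> ?S"
    unfolding f_def by (metis (no_types, lifting) wellorder_InfI)
  then show ?thesis by blast
qed

lemma weight_half_nat: "\<exists>k::nat. weight A \<T> = real k / 2"
  by (rule exI[of _ "2 * card \<T> + card {p. p \<subseteq> A \<and> card p = 2 \<and> \<not> (\<exists>t\<in>\<T>. p \<subseteq> t)}"])
     (simp add: weight_def field_simps)

lemma C_star_least:
  "\<exists>(A :: nat set) \<T>. finite A \<and> card A = a \<and> triple_system A \<T> \<and> C_star a = weight A \<T> \<and>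
     (\<forall>(A' :: nat set) \<T>'. finite A' \<and> card A' = a \<and> triple_system A' \<T>' \<longrightarrow> C_star a \<le> weight A' \<T>')"
proof -
  define P where "P w \<longleftrightarrow> (\<exists>(A :: nat set) \<T>. finite A \<and> card A = a \<and> triple_system A \<T> \<and> w = weight A \<T>)"
    for w
  have half: "\<exists>k::nat. w = real k / 2" if "P w" for w
    using that weight_half_nat unfolding P_def by blast
  have "P (weight {..<a} {})"
    unfolding P_def triple_system_def by (rule exI[of _ "{..<a}"], rule exI[of _ "{}"]) simp
  then have ex: "\<exists>k::nat. P (real k / 2)" using half by metis
  define k where "k = (LEAST k::nat. P (real k / 2))"
  have Pk: "P (real k / 2)" unfolding k_def using ex by (rule LeastI_ex)
  have le: "real k / 2 \<le> w" if Pw: "P w" for w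
  proof -
    from half[OF Pw] obtain j :: nat where j: "w = real j / 2" by blast
    have "k \<le> j" unfolding k_def using Pw unfolding j by (rule Least_le)
    then show ?thesis using j by simp
  qed
  have "C_star a = real k / 2"
    unfolding C_star_def P_def[symmetric] by (rule Least_equality) (use Pk le in auto)
  then show ?thesis using Pk le unfolding P_def by metis
qed

lemma C_star_attained:
  "\<exists>(A :: nat set) \<T>. finite A \<and> card A = a \<and> triple_system A \<T> \<and> C_star a = weight A \<T>"
  using C_star_least by blast

lemma C_star_le:
  fixes A :: "nat set"
  assumes "finite A" "card A = a" "triple_system A \<T>"
  shows "C_star a \<le> weight A \<T>"
  using C_star_least assms by blast

end

theory Submission
  imports Defs
begin

text \<open>
  Fix an \<open>(A, B)\<close>-system and a point \<open>x\<close> of \<open>A\<close>. For \<open>y\<close> in \<open>B\<close>, the blocks through \<open>x\<close> and \<open>y\<close> meet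
  \<open>A - {x}\<close> in sets of size at most 2, and these sets cover \<open>A - {x}\<close>. Charge each block
  with two or three points in \<open>A\<close> evenly to the pairs \<open>(x, y)\<close> in it. Since \<open>a - 1\<close> is odd, every pair is charged
  at least \<open>(2 * a - 1) / 12\<close> (lemma \<open>local_charge\<close>). The cheapest choice is one block with two points in \<open>A\<close>
  and otherwise blocks with three points in \<open>A\<close>, and everything else costs at least \<open>1 / 12\<close> more. The cheapest
  choice cannot occur at \<open>x\<close> for every \<open>y\<close>: a block with two points in \<open>A\<close> has two points in \<open>B\<close>, so
  \<open>B\<close> would be partitioned into pairs although \<open>b\<close> is odd (lemma \<open>point_charge\<close>). Summing over all pairs
  gives at least
  \<open>a * (b * (2 * a - 1) + 1) / 12 = (b - 1) * (a * (2 * a - 1) / 12) + a\<^sup>2 / 6\<close> blocks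
  (lemma \<open>AB_system_card_bound\<close>).

  It remains to bound the two covering numbers from above, by \<open>a * (2 * a - 1) / 12\<close> for \<open>C_star a\<close> and
  by \<open>a\<^sup>2 / 6\<close>, rounded up, for \<open>C a\<close>. The rounding matters only for \<open>a mod 6 = 2\<close>; in that case
  \<open>(b - 1) * (a * (2 * a - 1) / 12)\<close> is an integer, so the number of blocks can be rounded up as
  well. Both bounds come from explicit coverings of pairs by triples.
  The constructions of Bose (\<open>a mod 6 = 2\<close>) and Skolem (\<open>a mod 6 = 0\<close>) give
  Steiner triple systems on \<open>a + 1\<close> points, and deleting a point from one leaves a triple system of the required
  weight on \<open>a\<close> points (lemma \<open>C_star_le_if_coverable_Suc\<close>). For \<open>C (6 * k)\<close>, a variant of the Skolem
  construction closes up without the extra point (lemma \<open>coverable_6k\<close>). For \<open>C (6 * k + 2)\<close> one adds a point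
  to a Steiner triple system on \<open>6 * k + 1\<close> points (lemma \<open>coverable_add_point\<close>).
\<close>

section \<open>Coverings of pairs by triples\<close>

definition pair_covering :: "'v set \<Rightarrow> 'v set set \<Rightarrow> bool" where
  "pair_covering A \<T> \<longleftrightarrow> triple_system A \<T> \<and>
     (\<forall>x\<in>A. \<forall>y\<in>A. x \<noteq> y \<longrightarrow> (\<exists>t\<in>\<T>. x \<in> t \<and> y \<in> t))"

definition coverable :: "nat \<Rightarrow> nat \<Rightarrow> bool" where
  "coverable v N \<longleftrightarrow> (\<exists>\<T>. pair_covering {..<v} \<T> \<and> card \<T> \<le> N)"

lemma pair_covering_finite:
  assumes "pair_covering A \<T>" and "finite A"
  shows "finite \<T>"
proof (rule finite_subset)
  show "\<T> \<subseteq> Pow A"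
    using assms(1) unfolding pair_covering_def triple_system_def by blast
qed (use assms(2) in simp)

lemma coverableI:
  fixes A :: "'v set"
  assumes fin: "finite A" and cov: "pair_covering A \<T>" and card: "card \<T> \<le> N"
  shows "coverable (card A) N"
proof -
  obtain h where h: "bij_betw h A {0..<card A}"
    using ex_bij_betw_finite_nat[OF fin] by blast
  have inj: "inj_on h A" and img: "h ` A = {..<card A}"
    using h by (auto simp: bij_betw_def)
  have sub: "t \<subseteq> A" and c3: "card t = 3" if "t \<in> \<T>" for t
    using cov that by (auto simp: pair_covering_def triple_system_def)
  have "pair_covering {..<card A} ((`) h ` \<T>)"
    unfolding pair_covering_def triple_system_def
  proof (intro conjI ballI impI)
    fix t assume "t \<in> (`) h ` \<T>"
    then obtain s where s: "s \<in> \<T>" "t = h ` s" by blast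
    show "t \<subseteq> {..<card A}" using s sub[of s] img by blast
    show "card t = 3" using s sub[of s] c3[of s] inj by (simp add: card_image inj_on_subset)
  next
    fix x y assume xy: "x \<in> {..<card A}" "y \<in> {..<card A}" "x \<noteq> y"
    then obtain x' y' where "x' \<in> A" "y' \<in> A" "x = h x'" "y = h y'"
      unfolding img[symmetric] by blast
    moreover from this have "x' \<noteq> y'" using xy(3) by blast
    ultimately obtain t where "t \<in> \<T>" "x' \<in> t" "y' \<in> t"
      using cov unfolding pair_covering_def by blast
    with \<open>x = h x'\<close> \<open>y = h y'\<close> show "\<exists>t\<in>(`) h ` \<T>. x \<in> t \<and> y \<in> t" by blast
  qed
  moreover have "card ((`) h ` \<T>) \<le> N"
    using card_image_le[OF pair_covering_finite[OF cov fin], of "(`) h"] card by linarith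
  ultimately show ?thesis unfolding coverable_def by blast
qed

lemma C_le_if_coverable:
  assumes "coverable a N" and "a \<noteq> 2"
  shows "C a \<le> N"
proof -
  obtain \<T> where T: "pair_covering {..<a} \<T>" "card \<T> \<le> N"
    using assms(1) unfolding coverable_def by blast
  have "\<exists>t\<in>\<T>. p \<subseteq> t" if p2: "p \<subseteq> {..<a}" "card p = 2" for p
  proof -
    obtain x y where p: "p = {x, y}" "x \<noteq> y" using p2(2) by (auto simp: card_2_iff)
    then show ?thesis using T(1) p2(1) unfolding pair_covering_def by auto
  qed
  then have "C a \<le> card \<T>"
    unfolding C_def using assms(2) T(1)[unfolded pair_covering_def]
    by (auto intro!: Least_le exI[of _ "{..<a}"] exI[of _ \<T>])
  then show ?thesis using T(2) by linarith
qed

text \<open>Deleting a point that lies in \<open>r\<close> triples removes \<open>r\<close> triples and uncovers at most \<open>r\<close> pairs,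
  since an uncovered pair together with the deleted point was a triple. So the weight is
  at most \<open>N - r / 2\<close>. As the point is covered with each of the other \<open>v\<close>, two in a triple,
  \<open>r \<ge> v / 2\<close>. For a Steiner triple system the uncovered pairs form a perfect matching.\<close>

lemma C_star_le_if_coverable_Suc:
  assumes "coverable (Suc v) N"
  shows "C_star v \<le> real N - real v / 4"
proof -
  obtain \<T> where T: "pair_covering {..<Suc v} \<T>" "card \<T> \<le> N"
    using assms unfolding coverable_def by blast
  have finT: "finite \<T>" using pair_covering_finite[OF T(1)] by simp
  have tri: "t \<subseteq> {..<Suc v}" "card t = 3" "finite t" if "t \<in> \<T>" for t
    using T(1) that by (auto simp: pair_covering_def triple_system_def intro: finite_subset)
  have cov: "\<exists>t\<in>\<T>. x \<in> t \<and> y \<in> t" if "x < Suc v" "y < Suc v" "x \<noteq> y" for x y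
    using T(1) that unfolding pair_covering_def by blast
  define R where "R = {t \<in> \<T>. v \<in> t}"
  have finR: "finite R" and RT: "R \<subseteq> \<T>" using finT by (auto simp: R_def)
  define U where "U = {p. p \<subseteq> {..<v} \<and> card p = 2 \<and> \<not> (\<exists>t\<in>\<T> - R. p \<subseteq> t)}"
  have "triple_system {..<v} (\<T> - R)"
    unfolding triple_system_def
  proof (intro ballI conjI)
    fix t assume t: "t \<in> \<T> - R"
    then have "t \<subseteq> {..<Suc v}" "v \<notin> t" using tri(1)[of t] by (auto simp: R_def)
    then show "t \<subseteq> {..<v}" by (auto simp: less_Suc_eq)
    show "card t = 3" using t tri(2) by blast
  qed
  then have "C_star v \<le> weight {..<v} (\<T> - R)" by (intro C_star_le) auto
  also have "\<dots> = real (card (\<T> - R)) + real (card U) / 2" by (simp add: weight_def U_def)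
  finally have 1: "C_star v \<le> real (card \<T>) - real (card R) + real (card U) / 2"
    using finR RT by (simp add: card_Diff_subset card_mono finT of_nat_diff)
  have "card U \<le> card R"
  proof (rule card_inj_on_le[of "insert v"])
    show "inj_on (insert v) U"
    proof (rule inj_onI)
      fix p q assume pq: "p \<in> U" "q \<in> U" "insert v p = insert v q"
      have "v \<notin> p" "v \<notin> q" using pq(1,2) by (auto simp: U_def)
      then show "p = q" using pq(3) by (metis insert_ident)
    qed
    show "insert v ` U \<subseteq> R"
    proof (rule image_subsetI)
      fix p assume p: "p \<in> U"
      then obtain x y where xy: "p = {x, y}" "x \<noteq> y" by (auto simp: U_def card_2_iff)
      then have lt: "x < v" "y < v" using p by (auto simp: U_def)
      then obtain t where t: "t \<in> \<T>" "x \<in> t" "y \<in> t" using cov[of x y] xy(2) by auto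
      then have "p \<subseteq> t" using xy(1) by simp
      then have tR: "t \<in> R" using p t(1) by (auto simp: U_def)
      have "{v, x, y} = t"
        using tri(2,3)[OF t(1)] tR t lt xy(2)
        by (intro card_subset_eq) (auto simp: R_def)
      then show "insert v p \<in> R" using tR xy(1) by simp
    qed
  qed (rule finR)
  then have 2: "real (card U) \<le> real (card R)" by simp
  have "{..<v} \<subseteq> (\<Union>t\<in>R. t - {v})"
  proof
    fix x assume "x \<in> {..<v}"
    then obtain t where "t \<in> \<T>" "x \<in> t" "v \<in> t" using cov[of x v] by auto
    then show "x \<in> (\<Union>t\<in>R. t - {v})" using \<open>x \<in> {..<v}\<close> by (auto simp: R_def)
  qed
  then have "card {..<v} \<le> card (\<Union>t\<in>R. t - {v})"
    using finR RT tri(3) by (intro card_mono) auto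
  also have "\<dots> \<le> (\<Sum>t\<in>R. card (t - {v}))" by (rule card_UN_le[OF finR])
  also have "\<dots> = (\<Sum>t\<in>R. 2)"
    using tri(2,3) by (intro sum.cong) (auto simp: R_def)
  finally have "real v \<le> 2 * real (card R)" by simp
  with 1 2 T(2) show ?thesis by linarith
qed

lemma coverable_add_point:
  assumes "coverable v N" and v: "v = 2 * m + 1" and "m \<ge> 1"
  shows "coverable (Suc v) (N + m + 1)"
proof -
  obtain \<T> where T: "pair_covering {..<v} \<T>" "card \<T> \<le> N"
    using assms(1) unfolding coverable_def by blast
  \<comment> \<open>The new point is joined to a matching and one further pair, the one that wraps around to 0.\<close>
  define g where "g i = {v, 2 * i, (2 * i + 1) mod v}" for i
  have gdist: "2 * i < v \<and> (2 * i + 1) mod v < v \<and> 2 * i \<noteq> (2 * i + 1) mod v" if "i \<le> m" for i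
    using that v assms(3) by (cases "i = m") auto
  have new: "\<exists>i\<le>m. x \<in> g i" if "x < v" for x
  proof (rule exI[of _ "x div 2"], rule conjI)
    show "x div 2 \<le> m" using that v by auto
    show "x \<in> g (x div 2)" using that by (cases "even x") (auto simp: g_def odd_two_times_div_two_succ)
  qed
  have "pair_covering {..<Suc v} (\<T> \<union> g ` {..m})"
    unfolding pair_covering_def triple_system_def
  proof (intro conjI ballI impI)
    fix t assume t: "t \<in> \<T> \<union> g ` {..m}"
    have old: "t \<subseteq> {..<v} \<and> card t = 3" if "t \<in> \<T>"
      using that T(1) by (auto simp: pair_covering_def triple_system_def)
    show "t \<subseteq> {..<Suc v}" using t old gdist by (auto simp: g_def less_Suc_eq)
    show "card t = 3"
    proof (cases "t \<in> \<T>")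
      case False
      then obtain i where i: "i \<le> m" "t = g i" using t by blast
      then show ?thesis using gdist[of i] by (auto simp: g_def)
    qed (use old in blast)
  next
    fix x y assume xy: "x \<in> {..<Suc v}" "y \<in> {..<Suc v}" "x \<noteq> y"
    consider "x < v" "y < v" | "x = v" "y < v" | "x < v" "y = v" using xy by fastforce
    then show "\<exists>t\<in>\<T> \<union> g ` {..m}. x \<in> t \<and> y \<in> t"
    proof cases
      case 1
      then show ?thesis using T(1) xy(3) unfolding pair_covering_def by blast
    next
      case 2
      then show ?thesis using new[of y] by (auto simp: g_def)
    next
      case 3
      then show ?thesis using new[of x] by (auto simp: g_def)
    qed
  qed
  moreover have "card (\<T> \<union> g ` {..m}) \<le> N + m + 1"
    using card_Un_le[of \<T> "g ` {..m}"] card_image_le[of "{..m}" g] T(2) by simp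
  ultimately show ?thesis unfolding coverable_def by blast
qed

section \<open>The constructions of Bose and Skolem\<close>

text \<open>A commutative quasigroup on \<open>{..<n}\<close>, the cyclic group table relabelled so that the diagonal
  becomes as simple as possible. For odd \<open>n\<close> it is halving of \<open>i + j\<close> modulo \<open>n\<close>, which is
  idempotent; for even \<open>n\<close> only half of the elements can be squares.\<close>

definition half_sum :: "nat \<Rightarrow> nat \<Rightarrow> nat \<Rightarrow> nat" where
  "half_sum n i j = (let s = (i + j) mod n in if even s then s div 2 else (s + n) div 2)"

lemma half_sum_commute: "half_sum n i j = half_sum n j i"
  by (simp add: half_sum_def add.commute)

lemma half_sum_less: "n > 0 \<Longrightarrow> half_sum n i j < n"
  using mod_less_divisor[of n "i + j"] unfolding half_sum_def Let_def
  by (auto simp del: mod_less_divisor)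

lemma half_sum_solvable:
  assumes "i < n" and "c < n"
  shows "\<exists>i'<n. half_sum n i i' = c"
proof -
  define s where "s = (if 2 * c < n then 2 * c else if even n then 2 * c + 1 - n else 2 * c - n)"
  have s: "s < n" "(if even s then s div 2 else (s + n) div 2) = c"
    using assms unfolding s_def by (auto elim!: evenE oddE)
  have "(i + (s + n - i) mod n) mod n = (i + (s + n - i)) mod n" by (rule mod_add_right_eq)
  also have "\<dots> = s" using assms s(1) by simp
  finally have "half_sum n i ((s + n - i) mod n) = c" using s(2) by (simp add: half_sum_def)
  then show ?thesis using assms by (intro exI[of _ "(s + n - i) mod n"]) simp
qed

lemma half_sum_diag_odd: "i < 2 * k + 1 \<Longrightarrow> half_sum (2 * k + 1) i i = i"
proof -
  assume i: "i < 2 * k + 1"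
  have "(i + i) mod (2 * k + 1) = (if i \<le> k then 2 * i else 2 * i - (2 * k + 1))"
    using i by (auto simp: mod_if)
  then show ?thesis using i by (auto simp: half_sum_def Let_def)
qed

lemma half_sum_diag_even:
  assumes "i < k"
  shows "half_sum (2 * k) i i = i" and "half_sum (2 * k) (i + k) (i + k) = i"
proof -
  have "(i + i) mod (2 * k) = 2 * i" "(i + k + (i + k)) mod (2 * k) = 2 * i"
    using assms by (auto simp: mod_if)
  then show "half_sum (2 * k) i i = i" "half_sum (2 * k) (i + k) (i + k) = i"
    by (auto simp: half_sum_def Let_def)
qed

text \<open>The triples that the Bose and Skolem constructions have in common.\<close>

definition bose_triples :: "nat \<Rightarrow> (nat \<times> nat) set set" where
  "bose_triples n = (\<lambda>((i', i), j). {(i, j), (i', j), (half_sum n i i', (j + 1) mod 3)}) `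
     ((SIGMA i':{..<n}. {..<i'}) \<times> {..<3})"

lemma bose_triplesI:
  assumes "i < n" "i' < n" "i \<noteq> i'" "j < 3"
  shows "{(i, j), (i', j), (half_sum n i i', (j + 1) mod 3)} \<in> bose_triples n"
proof -
  have *: "{(i, j), (i', j), (half_sum n i i', (j + 1) mod 3)} \<in> bose_triples n"
    if "i < i'" "i' < n" "j < 3" for i i' j
    unfolding bose_triples_def using that by (intro image_eqI[of _ _ "((i', i), j)"]) auto
  show ?thesis
  proof (cases "i < i'")
    case True
    then show ?thesis using * assms by blast
  next
    case False
    then have "{(i', j), (i, j), (half_sum n i' i, (j + 1) mod 3)} \<in> bose_triples n"
      using * assms by simp
    then show ?thesis by (simp add: half_sum_commute insert_commute)
  qed
qed

lemma bose_triples_triple_system: "triple_system ({..<n} \<times> {..<3}) (bose_triples n)"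
  unfolding triple_system_def
proof (intro ballI conjI)
  fix t assume "t \<in> bose_triples n"
  then obtain i i' j where t: "i < i'" "i' < n" "j < 3"
    "t = {(i, j), (i', j), (half_sum n i i', (j + 1) mod 3)}"
    unfolding bose_triples_def by auto
  have "(j + 1) mod 3 \<noteq> j" using t(3) by presburger
  then show "card t = 3" using t by auto
  show "t \<subseteq> {..<n} \<times> {..<3}" using t half_sum_less[of n i i'] by auto
qed

lemma finite_bose_triples: "finite (bose_triples n)"
  unfolding bose_triples_def by auto

lemma card_bose_triples_le: "2 * card (bose_triples n) \<le> 3 * (n * (n - 1))"
proof -
  have "card (bose_triples n) \<le> card ((SIGMA i':{..<n}. {..<i'}) \<times> {..<3::nat})"
    unfolding bose_triples_def by (rule card_image_le) auto
  also have "\<dots> = (\<Sum>i<n. i) * 3" by (simp add: card_cartesian_product)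
  finally have "2 * card (bose_triples n) \<le> 3 * (2 * (\<Sum>i<n. i))" by simp
  also have "2 * (\<Sum>i<n. i) = n * (n - 1)"
  proof (induction n)
    case (Suc n)
    then show ?case by (cases n) auto
  qed simp
  finally show ?thesis .
qed

lemma less_3_cases: "(j::nat) < 3 \<Longrightarrow> j = 0 \<or> j = 1 \<or> j = 2"
  by auto

text \<open>The point \<open>(i, j)\<close> meets \<open>(c, j + 1)\<close> in the triple given by the solution \<open>i'\<close> of
  \<open>half_sum n i i' = c\<close>, unless \<open>i' = i\<close>. So only the diagonal of the table is
  left to be covered.\<close>

lemma bose_triples_cover:
  assumes x: "x \<in> {..<n} \<times> {..<3}" and y: "y \<in> {..<n} \<times> {..<3}" and "x \<noteq> y"
    and diag: "\<And>i j. i < n \<Longrightarrow> j < 3 \<Longrightarrow>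
      \<exists>t\<in>\<T>. (i, j) \<in> t \<and> (half_sum n i i, (j + 1) mod 3) \<in> t"
  shows "\<exists>t\<in>bose_triples n \<union> \<T>. x \<in> t \<and> y \<in> t"
proof -
  have up: "\<exists>t\<in>bose_triples n \<union> \<T>. (i, j) \<in> t \<and> (c, (j + 1) mod 3) \<in> t"
    if icj: "i < n" "c < n" "j < 3" for i c j
  proof -
    obtain i' where i': "i' < n" "half_sum n i i' = c"
      using half_sum_solvable[OF icj(1,2)] by blast
    show ?thesis
    proof (cases "i' = i")
      case True
      then show ?thesis using diag[of i j] i' icj by blast
    next
      case False
      then show ?thesis using bose_triplesI[of i n i' j] i' icj by blast
    qed
  qed
  obtain i j c l where xy: "x = (i, j)" "y = (c, l)" "i < n" "j < 3" "c < n" "l < 3"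
    using x y by auto
  consider "l = j" | "l = (j + 1) mod 3" | "j = (l + 1) mod 3"
    using less_3_cases[OF xy(4)] less_3_cases[OF xy(6)] by fastforce
  then show ?thesis
  proof cases
    case 1
    then have "i \<noteq> c" using xy \<open>x \<noteq> y\<close> by auto
    then show ?thesis using bose_triplesI[of i n c j] 1 xy by blast
  next
    case 2
    then show ?thesis using up[of i c j] xy by simp
  next
    case 3
    then show ?thesis using up[of c i l] xy by auto
  qed
qed

lemma card_Un_bose_le:
  assumes "finite I" and "3 * (n * (n - 1)) + 2 * card I \<le> 2 * N"
  shows "card (bose_triples n \<union> g ` I) \<le> N"
  using card_Un_le[of "bose_triples n" "g ` I"] card_image_le[OF assms(1), of g]
    card_bose_triples_le[of n] assms(2) by linarith

text \<open>The Bose construction: for odd \<open>n\<close> the table is idempotent, so the diagonal leaves the triangles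
  on the points \<open>(i, 0)\<close>, \<open>(i, 1)\<close>, \<open>(i, 2)\<close>, which are added as triples.\<close>

lemma coverable_6k3: "coverable (6 * k + 3) ((2 * k + 1) * (3 * k + 1))"
proof -
  define n where "n = 2 * k + 1"
  define g :: "nat \<Rightarrow> (nat \<times> nat) set" where "g i = {(i, 0), (i, 1), (i, 2)}" for i
  let ?A = "{..<n} \<times> {..<3::nat}" and ?T = "bose_triples n \<union> g ` {..<n}"
  have "pair_covering ?A ?T"
    unfolding pair_covering_def
  proof (intro conjI ballI impI)
    show "triple_system ?A ?T"
      using bose_triples_triple_system[of n] by (auto simp: triple_system_def g_def)
    fix x y assume "x \<in> ?A" "y \<in> ?A" "x \<noteq> y"
    then show "\<exists>t\<in>?T. x \<in> t \<and> y \<in> t"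
    proof (rule bose_triples_cover)
      fix i j :: nat assume ij: "i < n" "j < 3"
      then have "half_sum n i i = i" using half_sum_diag_odd by (simp add: n_def)
      then show "\<exists>t\<in>g ` {..<n}. (i, j) \<in> t \<and> (half_sum n i i, (j + 1) mod 3) \<in> t"
        using ij less_3_cases[OF ij(2)] by (auto simp: g_def)
    qed
  qed
  moreover have "card ?T \<le> (2 * k + 1) * (3 * k + 1)"
    by (rule card_Un_bose_le) (auto simp: n_def algebra_simps)
  ultimately have "coverable (card ?A) ((2 * k + 1) * (3 * k + 1))"
    by (intro coverableI[of ?A]) auto
  then show ?thesis by (simp add: n_def card_cartesian_product algebra_simps)
qed

lemma half_sum_even_cases:
  assumes "i < 2 * k"
  obtains "i < k" "half_sum (2 * k) i i = i"
    | m where "m < k" "i = m + k" "half_sum (2 * k) i i = m"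
proof (cases "i < k")
  case True
  then show ?thesis using that(1) half_sum_diag_even(1) by blast
next
  case False
  then have "i - k < k" "i = i - k + k" using assms by auto
  then show ?thesis using that(2)[of "i - k"] half_sum_diag_even(2)[of "i - k" k] by simp
qed

text \<open>For \<open>n = 2 * k\<close> the diagonal leaves, for every \<open>i < k\<close>, the triangle on the points \<open>(i, j)\<close> and
  the three pairs joining \<open>(i + k, j)\<close> to \<open>(i, j + 1)\<close>. Three triples cover these six pairs when
  each takes one side of the triangle and one pendant pair.\<close>

lemma coverable_6k: "coverable (6 * k) (6 * k\<^sup>2)"
proof -
  define n where "n = 2 * k"
  define g :: "nat \<times> nat \<Rightarrow> (nat \<times> nat) set"
    where "g = (\<lambda>(i, j). {(i + k, j), (i, (j + 1) mod 3), (i, (j + 2) mod 3)})"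
  let ?I = "{..<k} \<times> {..<3::nat}"
  let ?A = "{..<n} \<times> {..<3::nat}" and ?T = "bose_triples n \<union> g ` ?I"
  have gI: "g (i, j) \<in> g ` ?I" if "i < k" "j < 3" for i j
    using that by auto
  have "pair_covering ?A ?T"
    unfolding pair_covering_def
  proof (intro conjI ballI impI)
    have "card (g (i, j)) = 3" if "i < k" "j < 3" for i j
    proof -
      have "(j + 1) mod 3 \<noteq> (j + 2) mod 3" using that(2) by presburger
      then show ?thesis using that by (auto simp: g_def)
    qed
    moreover have "g (i, j) \<subseteq> ?A" if "i < k" "j < 3" for i j
      using that by (auto simp: g_def n_def)
    ultimately show "triple_system ?A ?T"
      using bose_triples_triple_system[of n] unfolding triple_system_def by blast
    fix x y assume "x \<in> ?A" "y \<in> ?A" "x \<noteq> y"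
    then show "\<exists>t\<in>?T. x \<in> t \<and> y \<in> t"
    proof (rule bose_triples_cover)
      fix i j :: nat assume ij: "i < n" "j < 3"
      from ij(1)[unfolded n_def]
      show "\<exists>t\<in>g ` ?I. (i, j) \<in> t \<and> (half_sum n i i, (j + 1) mod 3) \<in> t"
      proof (cases rule: half_sum_even_cases)
        case 1
        \<comment> \<open>The side from level \<open>j\<close> to \<open>j + 1\<close> lies in the triple whose pendant pair starts at level \<open>j - 1\<close>.\<close>
        have "((j + 2) mod 3 + 1) mod 3 = j" "((j + 2) mod 3 + 2) mod 3 = (j + 1) mod 3"
          using ij(2) by presburger+
        then show ?thesis
          using 1 by (intro bexI[OF _ gI[of i "(j + 2) mod 3"]]) (auto simp: g_def n_def)
      next
        case (2 m)
        then show ?thesis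
          using ij(2) by (intro bexI[OF _ gI[of m j]]) (auto simp: g_def n_def)
      qed
    qed
  qed
  moreover have "card ?T \<le> 6 * k\<^sup>2"
  proof (rule card_Un_bose_le)
    show "3 * (n * (n - 1)) + 2 * card ?I \<le> 2 * (6 * k\<^sup>2)"
      by (cases k) (auto simp: n_def card_cartesian_product algebra_simps power2_eq_square)
  qed simp
  ultimately have "coverable (card ?A) (6 * k\<^sup>2)"
    by (intro coverableI[of ?A]) auto
  then show ?thesis by (simp add: n_def card_cartesian_product)
qed

text \<open>The Skolem construction: an additional point turns the pendant pairs into triples, and the
  triangles are triples themselves.\<close>

lemma coverable_6k1: "coverable (6 * k + 1) (k * (6 * k + 1))"
proof -
  define n where "n = 2 * k"
  define \<omega> :: "nat \<times> nat" where "\<omega> = (n, 0)"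
  \<comment> \<open>The value \<open>j = 3\<close> stands for the triangle.\<close>
  define g :: "nat \<times> nat \<Rightarrow> (nat \<times> nat) set" where "g = (\<lambda>(i, j). if j = 3 then {(i, 0), (i, 1), (i, 2)}
    else {\<omega>, (i + k, j), (i, (j + 1) mod 3)})"
  let ?I = "{..<k} \<times> {..<4::nat}"
  let ?G = "{..<n} \<times> {..<3::nat}" and ?T = "bose_triples n \<union> g ` ?I"
  have gI: "g (i, j) \<in> g ` ?I" if "i < k" "j < 4" for i j
    using that by auto
  have omega: "\<exists>t\<in>?T. \<omega> \<in> t \<and> x \<in> t" if "x \<in> ?G" for x
  proof -
    obtain i j where x: "x = (i, j)" "i < 2 * k" "j < 3" using \<open>x \<in> ?G\<close> by (auto simp: n_def)
    show ?thesis
    proof (cases "i < k")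
      case True
      have *: "((j + 2) mod 3 + 1) mod 3 = j" "(j + 2) mod 3 < 4" "(j + 2) mod 3 \<noteq> 3"
        using x(3) by presburger+
      show ?thesis
        by (rule bexI[OF _ UnI2[OF gI[OF True *(2)]]]) (use * x in \<open>auto simp: g_def\<close>)
    next
      case False
      then have "i - k < k" "i = i - k + k" using x(2) by auto
      then show ?thesis
        using x by (intro bexI[OF _ UnI2[OF gI[of "i - k" j]]]) (auto simp: g_def)
    qed
  qed
  have "pair_covering (insert \<omega> ?G) ?T"
    unfolding pair_covering_def
  proof (intro conjI ballI impI)
    have "card (g (i, j)) = 3" if "i < k" for i j
      using that by (auto simp: g_def \<omega>_def n_def)
    moreover have "g (i, j) \<subseteq> insert \<omega> ?G" if "i < k" "j < 4" for i j
      using that by (auto simp: g_def n_def)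
    ultimately show "triple_system (insert \<omega> ?G) ?T"
      using bose_triples_triple_system[of n] unfolding triple_system_def by blast
    fix x y assume xy: "x \<in> insert \<omega> ?G" "y \<in> insert \<omega> ?G" "x \<noteq> y"
    show "\<exists>t\<in>?T. x \<in> t \<and> y \<in> t"
    proof (cases "x = \<omega> \<or> y = \<omega>")
      case True
      then show ?thesis using omega xy by blast
    next
      case False
      then have "x \<in> ?G" "y \<in> ?G" using xy by auto
      then show ?thesis using xy(3)
      proof (rule bose_triples_cover)
        fix i j :: nat assume ij: "i < n" "j < 3"
        from ij(1)[unfolded n_def]
        show "\<exists>t\<in>g ` ?I. (i, j) \<in> t \<and> (half_sum n i i, (j + 1) mod 3) \<in> t"
        proof (cases rule: half_sum_even_cases)
          case 1
          then show ?thesis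
            using less_3_cases[OF ij(2)]
            by (intro bexI[OF _ gI[of i 3]]) (auto simp: g_def n_def)
        next
          case (2 m)
          then show ?thesis
            using ij(2) by (intro bexI[OF _ gI[of m j]]) (auto simp: g_def n_def)
        qed
      qed
    qed
  qed
  moreover have "card ?T \<le> k * (6 * k + 1)"
  proof (rule card_Un_bose_le)
    show "3 * (n * (n - 1)) + 2 * card ?I \<le> 2 * (k * (6 * k + 1))"
      by (cases k) (auto simp: n_def card_cartesian_product algebra_simps)
  qed simp
  ultimately have "coverable (card (insert \<omega> ?G)) (k * (6 * k + 1))"
    by (intro coverableI[of "insert \<omega> ?G"]) auto
  then show ?thesis by (simp add: n_def card_cartesian_product \<omega>_def)
qed

lemma C_6k_le: "C (6 * k) \<le> 6 * k\<^sup>2"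
  by (rule C_le_if_coverable[OF coverable_6k]) presburger

lemma C_6k2_le: "C (6 * k + 2) \<le> 6 * k\<^sup>2 + 4 * k + 1"
proof (cases "k = 0")
  case True
  then show ?thesis by (simp add: C_def)
next
  case False
  have "coverable (Suc (6 * k + 1)) (k * (6 * k + 1) + 3 * k + 1)"
    by (rule coverable_add_point[OF coverable_6k1]) (use False in auto)
  then have "coverable (6 * k + 2) (6 * k\<^sup>2 + 4 * k + 1)"
    by (simp add: algebra_simps power2_eq_square)
  then show ?thesis by (rule C_le_if_coverable) (use False in simp)
qed

lemma C_star_le_formula:
  assumes "a mod 6 = 0 \<or> a mod 6 = 2"
  shows "C_star a \<le> real a * (2 * real a - 1) / 12"
  using assms
proof
  assume "a mod 6 = 0"
  then obtain k where a: "a = 6 * k" by (metis mod_0_imp_dvd dvd_def)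
  have "C_star a \<le> real (k * (6 * k + 1)) - real a / 4"
    using coverable_6k1[of k] by (intro C_star_le_if_coverable_Suc) (simp add: a)
  then show ?thesis by (simp add: a field_simps)
next
  assume "a mod 6 = 2"
  then obtain k where a: "a = 6 * k + 2" by (metis mult_div_mod_eq)
  have "C_star a \<le> real ((2 * k + 1) * (3 * k + 1)) - real a / 4"
    using coverable_6k3[of k] by (intro C_star_le_if_coverable_Suc) (simp add: a eval_nat_numeral)
  then show ?thesis by (simp add: a field_simps)
qed

section \<open>The counting bound\<close>

text \<open>Charges are scaled by twelve: a block with three points in \<open>A\<close> gives 4 to each of its three
  pairs in \<open>A \<times> B\<close>, a block with two points in \<open>A\<close> gives 3 to each of its four.\<close>

definition charge :: "nat \<Rightarrow> nat" where
  "charge k = (if k = 3 then 4 else if k = 2 then 3 else 0)"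

lemma AB_system_block:
  assumes "AB_system A B Q" and "finite A" "finite B" "A \<inter> B = {}" and "q \<in> Q"
  shows "q \<subseteq> A \<union> B" and "card q = 4" and "card (q \<inter> A) + card (q \<inter> B) = 4"
proof -
  show q: "q \<subseteq> A \<union> B" "card q = 4" using assms unfolding AB_system_def by auto
  have "card ((q \<inter> A) \<union> (q \<inter> B)) = card (q \<inter> A) + card (q \<inter> B)"
    using assms by (intro card_Un_disjoint) auto
  moreover have "(q \<inter> A) \<union> (q \<inter> B) = q" using q(1) by blast
  ultimately show "card (q \<inter> A) + card (q \<inter> B) = 4" using q(2) by simp
qed

lemma AB_system_finite:
  assumes "AB_system A B Q" and "finite A" "finite B"
  shows "finite Q"
  by (rule finite_subset[of _ "Pow (A \<union> B)"]) (use assms in \<open>auto simp: AB_system_def\<close>)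

text \<open>At \<open>(x, y)\<close> let \<open>t\<close> and \<open>s\<close> be the numbers of blocks with three and two points in \<open>A\<close>. They have to
  reach the other \<open>a - 1\<close> points of \<open>A\<close>, so \<open>2 * t + s \<ge> a - 1\<close>. The charge is
  \<open>2 * (2 * t + s) + s\<close>, and for \<open>s = 0\<close> the oddness of \<open>a - 1\<close> forces \<open>2 * t \<ge> a\<close>.\<close>

lemma local_charge:
  fixes A B :: "'v set"
  assumes Q: "AB_system A B Q" and fin: "finite A" "finite B" and disj: "A \<inter> B = {}"
    and "even (card A)" and x: "x \<in> A" and y: "y \<in> B"
  defines "D \<equiv> (\<Sum>q | q \<in> Q \<and> x \<in> q \<and> y \<in> q. charge (card (q \<inter> A)))"
    and "s \<equiv> card {q \<in> Q. x \<in> q \<and> y \<in> q \<and> card (q \<inter> A) = 2}"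
  shows "D \<ge> 2 * card A - 1" and "D = 2 * card A - 1 \<Longrightarrow> s = 1"
proof -
  note blk = AB_system_block[OF Q fin disj] and finQ = AB_system_finite[OF Q fin]
  define P where "P = {q \<in> Q. x \<in> q \<and> y \<in> q}"
  have finP: "finite P" using finQ by (simp add: P_def)
  have small: "card (q \<inter> A) \<in> {1, 2, 3}" if "q \<in> P" for q
  proof -
    have q: "q \<in> Q" "x \<in> q" "y \<in> q" using that by (auto simp: P_def)
    have "card (q \<inter> B) \<noteq> 0" using q y fin(2) by auto
    then have "card (q \<inter> A) \<le> 3" using blk(3)[OF q(1)] by linarith
    moreover have "card (q \<inter> A) \<noteq> 0" using q x fin(1) by auto
    ultimately show ?thesis by auto
  qed
  define P3 where "P3 = {q \<in> P. card (q \<inter> A) = 3}"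
  define P2 where "P2 = {q \<in> P. card (q \<inter> A) = 2}"
  have fins: "finite P2" "finite P3" using finP by (auto simp: P2_def P3_def)
  have split: "(\<Sum>q\<in>P. h (card (q \<inter> A))) = h 3 * card P3 + h 2 * card P2"
    if "h (Suc 0) = 0" for h :: "nat \<Rightarrow> nat"
  proof -
    have "(\<Sum>q\<in>P. h (card (q \<inter> A))) =
        (\<Sum>q\<in>P. (if card (q \<inter> A) = 3 then h 3 else 0) + (if card (q \<inter> A) = 2 then h 2 else 0))"
      using small that by (intro sum.cong refl) fastforce
    then show ?thesis
      using finP by (simp add: sum.distrib sum.If_cases P3_def P2_def Int_def)
  qed
  have D: "D = 4 * card P3 + 3 * card P2"
    unfolding D_def P_def[symmetric] using split[of charge] by (simp add: charge_def)
  have s: "s = card P2" unfolding s_def P2_def P_def by (rule arg_cong[of _ _ card]) auto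
  have "A - {x} \<subseteq> (\<Union>q\<in>P. q \<inter> A - {x})"
  proof
    fix z assume z: "z \<in> A - {x}"
    have "x \<noteq> y" "z \<noteq> y" using x y z disj by auto
    moreover have "{x, z, y} \<inter> A = {x, z}" using x y z disj by auto
    ultimately have "{x, z, y} \<subseteq> A \<union> B" "card {x, z, y} = 3" "card ({x, z, y} \<inter> A) \<ge> 2"
      using x y z by auto
    then obtain q where "q \<in> Q" "{x, z, y} \<subseteq> q" using Q unfolding AB_system_def by blast
    then show "z \<in> (\<Union>q\<in>P. q \<inter> A - {x})" using z by (auto simp: P_def)
  qed
  then have "card (A - {x}) \<le> card (\<Union>q\<in>P. q \<inter> A - {x})"
    using fin finP by (intro card_mono) auto
  also have "\<dots> \<le> (\<Sum>q\<in>P. card (q \<inter> A - {x}))" by (rule card_UN_le[OF finP])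
  also have "\<dots> = (\<Sum>q\<in>P. card (q \<inter> A) - 1)"
    using x fin by (intro sum.cong refl) (simp add: P_def)
  also have "\<dots> = 2 * card P3 + card P2" using split[of "\<lambda>n. n - 1"] by simp
  finally have reach: "card A - 1 \<le> 2 * card P3 + card P2" using x fin by simp
  obtain n where n: "card A = 2 * n" using \<open>even (card A)\<close> by (rule evenE)
  have "card A \<noteq> 0" using x fin by auto
  with n have "n \<ge> 1" by simp
  have "D \<ge> 2 * card A" if "s = 0"
  proof -
    have "2 * n - 1 \<le> 2 * card P3" using reach n s that by simp
    then have "n \<le> card P3" using \<open>n \<ge> 1\<close> by linarith
    then show ?thesis using D n by simp
  qed
  moreover have "D \<ge> 2 * card A - 2 + s" using reach D s by linarith
  ultimately show "D \<ge> 2 * card A - 1" "D = 2 * card A - 1 \<Longrightarrow> s = 1"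
    using n \<open>n \<ge> 1\<close> by (cases "s = 0"; linarith)+
qed

text \<open>If no \<open>y\<close> gave a surplus at \<open>x\<close>, every \<open>y\<close> would lie with \<open>x\<close> in exactly one block with two
  points in \<open>A\<close>. These blocks would split \<open>B\<close> into pairs, which is impossible for odd \<open>card B\<close>.\<close>

lemma point_charge:
  fixes A B :: "'v set"
  assumes Q: "AB_system A B Q" and fin: "finite A" "finite B" and disj: "A \<inter> B = {}"
    and "even (card A)" and "odd (card B)" and x: "x \<in> A"
  shows "(\<Sum>y\<in>B. \<Sum>q | q \<in> Q \<and> x \<in> q \<and> y \<in> q. charge (card (q \<inter> A)))
    \<ge> card B * (2 * card A - 1) + 1"
proof -
  define D where "D y = (\<Sum>q | q \<in> Q \<and> x \<in> q \<and> y \<in> q. charge (card (q \<inter> A)))" for y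
  define s where "s y = card {q \<in> Q. x \<in> q \<and> y \<in> q \<and> card (q \<inter> A) = 2}" for y
  note loc = local_charge[OF Q fin disj \<open>even (card A)\<close> x, folded D_def s_def]
  have "\<exists>y\<in>B. D y \<noteq> 2 * card A - 1"
  proof (rule ccontr)
    assume "\<not> ?thesis"
    then have s1: "s y = 1" if "y \<in> B" for y using loc(2) that by blast
    define R where "R = {q \<in> Q. x \<in> q \<and> card (q \<inter> A) = 2}"
    have finR: "finite R" using AB_system_finite[OF Q fin] by (simp add: R_def)
    have two: "card {y \<in> B. y \<in> q} = 2" if "q \<in> R" for q
    proof -
      have q: "q \<in> Q" "card (q \<inter> A) = 2" using that by (auto simp: R_def)
      have "{y \<in> B. y \<in> q} = q \<inter> B" by auto
      then show ?thesis using AB_system_block(3)[OF Q fin disj q(1)] q(2) by simp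
    qed
    have "card B = (\<Sum>y\<in>B. card {q \<in> R. y \<in> q})"
      using s1 by (simp add: s_def R_def conj_ac)
    also have "\<dots> = 2 * card R"
      by (rule sum_multicount) (use fin finR two in auto)
    finally show False using \<open>odd (card B)\<close> by simp
  qed
  then obtain y0 where y0: "y0 \<in> B" "D y0 \<noteq> 2 * card A - 1" by blast
  have "D y0 \<ge> 2 * card A - 1 + 1" using loc(1)[OF y0(1)] y0(2) by linarith
  moreover have "(\<Sum>y\<in>B - {y0}. 2 * card A - 1) \<le> sum D (B - {y0})"
    by (rule sum_mono) (simp add: loc(1) del: One_nat_def)
  ultimately have "(\<Sum>y\<in>B. 2 * card A - 1) + 1 \<le> sum D B"
    unfolding sum.remove[OF fin(2) y0(1)] by linarith
  then show ?thesis by (simp add: D_def)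
qed

lemma AB_system_card_bound:
  fixes A B :: "'v set"
  assumes Q: "AB_system A B Q" and fin: "finite A" "finite B" and disj: "A \<inter> B = {}"
    and "even (card A)" and "odd (card B)"
  shows "card A * (card B * (2 * card A - 1) + 1) \<le> 12 * card Q"
proof -
  note blk = AB_system_block[OF Q fin disj] and finQ = AB_system_finite[OF Q fin]
  let ?c = "\<lambda>q. charge (card (q \<inter> A))"
  have "card A * (card B * (2 * card A - 1) + 1) = (\<Sum>x\<in>A. card B * (2 * card A - 1) + 1)"
    by simp
  also have "\<dots> \<le> (\<Sum>x\<in>A. \<Sum>y\<in>B. \<Sum>q | q \<in> Q \<and> x \<in> q \<and> y \<in> q. ?c q)"
    by (rule sum_mono) (rule point_charge[OF assms])
  also have "\<dots> = (\<Sum>z\<in>A \<times> B. \<Sum>q | q \<in> Q \<and> fst z \<in> q \<and> snd z \<in> q. ?c q)"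
    by (simp add: sum.cartesian_product case_prod_beta)
  also have "\<dots> = (\<Sum>q\<in>Q. \<Sum>z | z \<in> A \<times> B \<and> fst z \<in> q \<and> snd z \<in> q. ?c q)"
    by (rule sum.swap_restrict) (use fin finQ in auto)
  also have "\<dots> \<le> (\<Sum>q\<in>Q. 12)"
  proof (rule sum_mono)
    fix q assume q: "q \<in> Q"
    have "{z. z \<in> A \<times> B \<and> fst z \<in> q \<and> snd z \<in> q} = (q \<inter> A) \<times> (q \<inter> B)" by auto
    moreover have "card (q \<inter> A) + card (q \<inter> B) = 4" by (rule blk(3)[OF q])
    ultimately show "(\<Sum>z | z \<in> A \<times> B \<and> fst z \<in> q \<and> snd z \<in> q. ?c q) \<le> 12"
      by (auto simp: card_cartesian_product charge_def)
  qed
  finally show ?thesis by simp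
qed

section \<open>The bound in terms of covering numbers\<close>

theorem theorem2p5:
  fixes a b :: nat
  assumes "a > 0" and "a mod 6 = 0 \<or> a mod 6 = 2" and "odd b"
  shows "ereal_of_enat (f a b) \<ge> ereal ((real b - 1) * C_star a + real (C a))"
proof (cases "f a b = \<infinity>")
  case True
  then show ?thesis by simp
next
  case False
  from f_attained[OF this] obtain A B :: "nat set" and Q where AB: "finite A" "finite B"
    "A \<inter> B = {}" "card A = a" "card B = b" "AB_system A B Q" and f: "f a b = enat (card Q)"
    by (elim exE conjE)
  obtain m where b: "b = 2 * m + 1" using assms(3) by (rule oddE)
  have "even a" using assms(2) by presburger
  then have bound: "a * (b * (2 * a - 1) + 1) \<le> 12 * card Q"
    using AB_system_card_bound[OF AB(6,1,2,3)] AB(4,5) assms(3) by simp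
  have "(real b - 1) * C_star a \<le> 2 * real m * (real a * (2 * real a - 1) / 12)"
    using mult_left_mono[OF C_star_le_formula[OF assms(2)], of "2 * real m"] by (simp add: b)
  moreover have "2 * real m * (real a * (2 * real a - 1) / 12) + real (C a) \<le> real (card Q)"
    using assms(2)
  proof
    assume "a mod 6 = 0"
    then obtain k where a: "a = 6 * k" by (metis mod_0_imp_dvd dvd_def)
    have k: "k \<ge> 1" using a assms(1) by simp
    have odd_part: "real (2 * a - 1) = 12 * real k - 1" using k by (simp add: a of_nat_diff)
    have "real (a * (b * (2 * a - 1) + 1)) \<le> real (12 * card Q)" using bound by (rule of_nat_mono)
    then have "real a * (real b * (12 * real k - 1) + 1) \<le> 12 * real (card Q)"
      by (simp only: of_nat_add of_nat_mult of_nat_1 odd_part of_nat_numeral)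
    moreover have "real (C a) \<le> real (6 * k\<^sup>2)"
      unfolding a using C_6k_le by (rule of_nat_mono)
    ultimately show ?thesis by (simp add: a b field_simps power2_eq_square)
  next
    assume "a mod 6 = 2"
    then obtain k where a: "a = 6 * k + 2" by (metis mult_div_mod_eq)
    \<comment> \<open>Here \<open>(b - 1) * C_star a\<close> is bounded by the integer \<open>m * (3 * k + 1) * (4 * k + 1)\<close>, so the
      fraction 2/3 left by the count can be rounded up to 1.\<close>
    have "2 * a - 1 = 12 * k + 3" using a by simp
    then have "12 * (m * (3 * k + 1) * (4 * k + 1)) + 12 * (6 * k\<^sup>2 + 4 * k) + 8 \<le> 12 * card Q"
      using bound by (simp add: a b algebra_simps power2_eq_square)
    moreover have "X + (Y + 1) \<le> q" if "12 * X + 12 * Y + 8 \<le> 12 * q" for X Y q :: nat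
      using that by presburger
    ultimately have "m * (3 * k + 1) * (4 * k + 1) + (6 * k\<^sup>2 + 4 * k + 1) \<le> card Q" by blast
    then have "m * (3 * k + 1) * (4 * k + 1) + C a \<le> card Q"
      using C_6k2_le[of k] by (simp add: a)
    then have "real (m * (3 * k + 1) * (4 * k + 1) + C a) \<le> real (card Q)" by (rule of_nat_mono)
    then show ?thesis by (simp add: a field_simps)
  qed
  ultimately show ?thesis by (simp add: f)
qed

end
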